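(* Suppose the features $f:\mathsf{Z}\to\underline{\mathbb{R}}^p$ and the samples $\{z_i=(x_i,u_i),x_i^+,r_i\}_{i\in[1:n]}$ satisfy (1) for every $z\in\mathsf{Z}$ there exists $j\in[1:p]$ with $[f]_j(z)\neq-\infty$; and (2) for every $j\in[1:p]$ there exists $i\in[1:n]$ with $[f]_j(z_i)\neq-\infty$. Then the operator $\mathbf{D}:\mathbb{R}^p\to\mathbb{R}^p$ defined by $$\mathbf{D}\theta = -\left[F_{\mathrm{s}}^{\top}\boxtimes\big[-\big(G_{\mathrm{s}}\boxtimes(\gamma\theta)\big)\big]\right]$$ is a $\gamma$-contraction in the $\infty$-norm, i.e., $\|\mathbf{D}\theta_1-\mathbf{D}\theta_2\|_\infty\le\gamma\|\theta_1-\theta_2\|_\infty$ for all $\theta_1,\theta_2\in\mathbb{R}^p$.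
   Context: Notation: $\underline{\mathbb{R}}=\mathbb{R}\cup\{-\infty\}$ with the usual conventions ($-\infty+a=-\infty$, $\gamma\cdot(-\infty)=-\infty$); $[1:n]=\{1,\dots,n\}$; $[v]_i$ and $[M]_{i,j}$ denote entries. For $A\in\underline{\mathbb{R}}^{n\times m}$, $B\in\underline{\mathbb{R}}^{m\times p}$, the max-plus product $A\boxtimes B\in\underline{\mathbb{R}}^{n\times p}$ has entries $[A\boxtimes B]_{i,j}=\max_{k\in[1:m]}\{[A]_{i,k}+[B]_{k,j}\}$; the notation applies to vectors as one-column matrices. $\gamma\theta$ and $-v$ denote ordinary scalar multiplication and negation. Setting: $\mathsf{Z}=\mathsf{X}\times\mathsf{U}$ where $\mathsf{X}\subset\mathbb{R}^{d_{\mathrm{x}}}$, $\mathsf{U}\subset\mathbb{R}^{d_{\mathrm{u}}}$ are nonempty state and action spaces; $\gamma\in(0,1)$ is the discount factor. The data are $n\in\mathbb{N}$ samples $\{z_i=(x_i,u_i),x_i^+,r_i\}_{i\in[1:n]}$ with $z_i\in\mathsf{Z}$, $x_i^+\in\mathsf{X}$, $r_i\in\mathbb{R}$. For $Q:\mathsf{Z}\to\underline{\mathbb{R}}$ the empirical Bellman operator is $\mathbf{B}_{\mathrm{s}}Q(z_i)=r_i+\gamma\max_{u^+\in\mathsf{U}}Q(x_i^+,u^+)$, $i\in[1:n]$. The maxima over $u^+$ of the features are assumed to exist in $\underline{\mathbb{R}}$. Given features $f:\mathsf{Z}\to\underline{\mathbb{R}}^p$, the matrices $F_{\mathrm{s}},G_{\mathrm{s}}\in\underline{\mathbb{R}}^{n\times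 p}$ have entries $[F_{\mathrm{s}}]_{i,j}=[f]_j(z_i)$ and $[G_{\mathrm{s}}]_{i,j}=\mathbf{B}_{\mathrm{s}}[f]_j(z_i)$. *)

theory Defs
  imports "HOL-Analysis.Analysis"
begin

(* The set of reals with -\<infinity> is modelled inside ereal by the values different from \<infinity>; on it
   the operations +, * by a positive real, \<le> and max of ereal follow the max-plus conventions.
   Negating -\<infinity> gives \<infinity>, so formulas with a negation have to be shown to stay finite. *)

definition mp_mult :: "ereal^'m^'n \<Rightarrow> ereal^'k^'m \<Rightarrow> ereal^'k^'n"  (infixl "\<boxtimes>" 70) where
  "A \<boxtimes> B = (\<chi> i j. Max (range (\<lambda>k. A $ i $ k + B $ k $ j)))"

definition mp_mult_vec :: "ereal^'m^'n \<Rightarrow> ereal^'m \<Rightarrow> ereal^'n"  (infixl "\<boxtimes>v" 70) where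
  "A \<boxtimes>v v = (\<chi> i. Max (range (\<lambda>k. A $ i $ k + v $ k)))"

lemma columnvector_mp_mult_vec: "columnvector (A \<boxtimes>v v) = A \<boxtimes> columnvector v"
  by (simp add: columnvector_def mp_mult_def mp_mult_vec_def vec_eq_iff)

definition ereal_vec :: "real^'m \<Rightarrow> ereal^'m" where
  "ereal_vec v = (\<chi> j. ereal (v $ j))"

definition has_max_on :: "('a \<Rightarrow> ereal) \<Rightarrow> 'a set \<Rightarrow> bool" where
  "has_max_on g S \<longleftrightarrow> (\<exists>s\<in>S. \<forall>t\<in>S. g t \<le> g s)"

(* The value at the i-th sample. It is indexed by i rather than by z_i because samples may share
   the same z_i. The supremum is the maximum whenever has_max_on holds. *)
definition bellman_s ::
  "'u set \<Rightarrow> real \<Rightarrow> ('n \<Rightarrow> 'x) \<Rightarrow> ('n \<Rightarrow> real) \<Rightarrow> ('x \<times> 'u \<Rightarrow> ereal) \<Rightarrow> 'n \<Rightarrow> ereal" where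
  "bellman_s U \<gamma> xp r Q i = ereal (r i) + ereal \<gamma> * (SUP u\<in>U. Q (xp i, u))"

lemma has_max_on_SUP:
  assumes "has_max_on g S"
  shows "(SUP s\<in>S. g s) \<in> g ` S" "\<And>t. t \<in> S \<Longrightarrow> g t \<le> (SUP s\<in>S. g s)"
proof -
  obtain s where s: "s \<in> S" "\<forall>t\<in>S. g t \<le> g s"
    using assms by (auto simp: has_max_on_def)
  then have "(SUP s\<in>S. g s) = g s"
    by (intro antisym SUP_least SUP_upper) auto
  with s show "(SUP s\<in>S. g s) \<in> g ` S" by auto
qed (auto intro: SUP_upper)

definition F_s :: "('z \<Rightarrow> ereal^'p) \<Rightarrow> ('n \<Rightarrow> 'z) \<Rightarrow> ereal^'p^'n" where
  "F_s f z = (\<chi> i j. f (z i) $ j)"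

definition G_s ::
  "'u set \<Rightarrow> real \<Rightarrow> ('x \<times> 'u \<Rightarrow> ereal^'p) \<Rightarrow> ('n \<Rightarrow> 'x) \<Rightarrow> ('n \<Rightarrow> real) \<Rightarrow> ereal^'p^'n" where
  "G_s U \<gamma> f xp r = (\<chi> i j. bellman_s U \<gamma> xp r (\<lambda>z. f z $ j) i)"

definition D_ext :: "real \<Rightarrow> ereal^'p^'n \<Rightarrow> ereal^'p^'n \<Rightarrow> real^'p \<Rightarrow> ereal^'p" where
  "D_ext \<gamma> F G \<theta> = - (transpose F \<boxtimes>v (- (G \<boxtimes>v ereal_vec (\<gamma> *\<^sub>R \<theta>))))"

(* real_of_ereal sends infinite values to 0, so this is the intended operator only when
   D_ext has finite entries, i.e. when ereal_vec (D_op \<gamma> F G \<theta>) = D_ext \<gamma> F G \<theta>. *)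
definition D_op :: "real \<Rightarrow> ereal^'p^'n \<Rightarrow> ereal^'p^'n \<Rightarrow> real^'p \<Rightarrow> real^'p" where
  "D_op \<gamma> F G \<theta> = (\<chi> j. real_of_ereal (D_ext \<gamma> F G \<theta> $ j))"

end

theory Submission
  imports Defs
begin

text \<open>
  The operator is a composition of maps that are non-expansive in the \<open>\<infinity>\<close>-norm with
  scaling by \<open>\<gamma>\<close>. A max-plus matrix \<open>M\<close> over the reals with \<open>-\<infinity>\<close>, each of whose rows has a
  finite entry, maps real vectors to real vectors: each component of the image is a maximum over a
  finite set of numbers below \<open>\<infinity>\<close>, one of which is finite. The real map so obtained is monotone
  and commutes with adding a constant to all components, and therefore is non-expansive
  (\<open>row_regular_nonexpansive\<close>).

  Both \<open>G\<close> and the transpose of \<open>F\<close> are such matrices. For \<open>G\<close>, the first condition on the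
  features, applied at \<open>(xp i, u')\<close> for any action \<open>u'\<close>, gives a feature whose maximum over the
  actions is finite; for the transpose of \<open>F\<close>, the second condition is exactly what is needed.
  Negation preserves the norm, so only the factor \<open>\<gamma>\<close> from the scaling remains.
\<close>

text \<open>
  Matrices over the reals with \<open>-\<infinity>\<close> that have a finite entry in every row.
\<close>

definition row_regular :: "ereal^'m^'n \<Rightarrow> bool" where
  "row_regular M \<longleftrightarrow> (\<forall>i k. M $ i $ k \<noteq> \<infinity>) \<and> (\<forall>i. \<exists>k. M $ i $ k \<noteq> -\<infinity>)"

lemma infnorm_le_cart:
  fixes v :: "real^'m"
  assumes "\<And>i. \<bar>v $ i\<bar> \<le> c"
  shows "infnorm v \<le> c"
  unfolding infnorm_cart by (rule cSup_least) (use assms in auto)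

lemma mp_mult_vec_finite:
  assumes "row_regular M"
  shows "\<bar>(M \<boxtimes>v ereal_vec v) $ i\<bar> \<noteq> \<infinity>"
proof -
  let ?S = "range (\<lambda>k. M $ i $ k + ereal (v $ k))"
  obtain k where k: "M $ i $ k \<noteq> -\<infinity>"
    using assms unfolding row_regular_def by blast
  have "Max ?S \<in> ?S"
    by (rule Max_in) auto
  then obtain l where "Max ?S = M $ i $ l + ereal (v $ l)"
    by (rule imageE)
  with assms have "Max ?S \<noteq> \<infinity>"
    by (simp add: row_regular_def)
  moreover have "M $ i $ k + ereal (v $ k) \<le> Max ?S"
    by (rule Max_ge) auto
  moreover have "M $ i $ k + ereal (v $ k) \<noteq> -\<infinity>"
    using k by simp
  ultimately have "\<bar>Max ?S\<bar> \<noteq> \<infinity>"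
    by (metis ereal_infty_less_eq(2) ereal_infinity_cases)
  then show ?thesis
    by (simp add: mp_mult_vec_def ereal_vec_def)
qed

lemma mp_mult_vec_le_add:
  assumes "\<And>k. v $ k \<le> w $ k + c"
  shows "(M \<boxtimes>v ereal_vec v) $ i \<le> (M \<boxtimes>v ereal_vec w) $ i + ereal c"
proof -
  let ?S = "range (\<lambda>k. M $ i $ k + ereal (w $ k))"
  have "M $ i $ k + ereal (v $ k) \<le> Max ?S + ereal c" for k
  proof -
    have "M $ i $ k + ereal (v $ k) \<le> M $ i $ k + (ereal (w $ k) + ereal c)"
      using assms[of k] by (intro add_left_mono) simp
    also have "\<dots> = (M $ i $ k + ereal (w $ k)) + ereal c"
      by (simp only: add.assoc)
    also have "\<dots> \<le> Max ?S + ereal c"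
      by (intro add_right_mono Max_ge) auto
    finally show ?thesis .
  qed
  then show ?thesis
    by (simp add: mp_mult_vec_def ereal_vec_def)
qed

lemma row_regular_nonexpansive:
  fixes M :: "ereal^'m^'n"
  assumes "row_regular M"
  obtains h :: "real^'m \<Rightarrow> real^'n"
  where "\<And>v. M \<boxtimes>v ereal_vec v = ereal_vec (h v)"
    and "\<And>v w. infnorm (h v - h w) \<le> infnorm (v - w)"
proof -
  define h :: "real^'m \<Rightarrow> real^'n"
    where "h v = (\<chi> i. real_of_ereal ((M \<boxtimes>v ereal_vec v) $ i))" for v
  have h: "M \<boxtimes>v ereal_vec v = ereal_vec (h v)" for v
    using mp_mult_vec_finite[OF assms]
    by (simp add: h_def ereal_vec_def vec_eq_iff ereal_real')
  have le: "h v $ i \<le> h w $ i + infnorm (v - w)" for v w i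
  proof -
    have "v $ k \<le> w $ k + infnorm (v - w)" for k
      using component_le_infnorm_cart[of "v - w" k] by simp
    from mp_mult_vec_le_add[OF this, of M i] show ?thesis
      by (simp add: h) (simp add: ereal_vec_def)
  qed
  have "infnorm (h v - h w) \<le> infnorm (v - w)" for v w
  proof (rule infnorm_le_cart)
    fix i
    show "\<bar>(h v - h w) $ i\<bar> \<le> infnorm (v - w)"
      using le[of v i w] le[of w i v] by (simp add: infnorm_sub[of w v] abs_le_iff)
  qed
  with h show thesis by (rule that)
qed

lemma uminus_ereal_vec: "- ereal_vec v = ereal_vec (- v)"
  by (simp add: ereal_vec_def vec_eq_iff)

lemma D_op_contraction:
  assumes F: "row_regular (transpose F)" and G: "row_regular G" and "0 \<le> \<gamma>"
  shows "ereal_vec (D_op \<gamma> F G \<theta>) = D_ext \<gamma> F G \<theta>"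
    and "infnorm (D_op \<gamma> F G \<theta>1 - D_op \<gamma> F G \<theta>2) \<le> \<gamma> * infnorm (\<theta>1 - \<theta>2)"
proof -
  obtain hF where hF: "\<And>v. transpose F \<boxtimes>v ereal_vec v = ereal_vec (hF v)"
      "\<And>v w. infnorm (hF v - hF w) \<le> infnorm (v - w)"
    using row_regular_nonexpansive[OF F] by blast
  obtain hG where hG: "\<And>v. G \<boxtimes>v ereal_vec v = ereal_vec (hG v)"
      "\<And>v w. infnorm (hG v - hG w) \<le> infnorm (v - w)"
    using row_regular_nonexpansive[OF G] by blast
  have ext: "D_ext \<gamma> F G \<theta> = ereal_vec (- hF (- hG (\<gamma> *\<^sub>R \<theta>)))" for \<theta>
    by (simp add: D_ext_def hF hG uminus_ereal_vec)
  have op: "D_op \<gamma> F G \<theta> = - hF (- hG (\<gamma> *\<^sub>R \<theta>))" for \<theta>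
    by (simp add: D_op_def ext) (simp add: ereal_vec_def vec_eq_iff)
  show "ereal_vec (D_op \<gamma> F G \<theta>) = D_ext \<gamma> F G \<theta>"
    by (simp add: op ext)
  have neg: "infnorm (- a - - b) = infnorm (a - b)" for a b :: "real^'k"
    using infnorm_neg[of "a - b"] by (simp add: algebra_simps)
  have "infnorm (D_op \<gamma> F G \<theta>1 - D_op \<gamma> F G \<theta>2)
      = infnorm (hF (- hG (\<gamma> *\<^sub>R \<theta>1)) - hF (- hG (\<gamma> *\<^sub>R \<theta>2)))"
    unfolding op by (rule neg)
  also have "\<dots> \<le> infnorm (- hG (\<gamma> *\<^sub>R \<theta>1) - - hG (\<gamma> *\<^sub>R \<theta>2))"
    by (rule hF)
  also have "\<dots> = infnorm (hG (\<gamma> *\<^sub>R \<theta>1) - hG (\<gamma> *\<^sub>R \<theta>2))"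
    by (rule neg)
  also have "\<dots> \<le> infnorm (\<gamma> *\<^sub>R \<theta>1 - \<gamma> *\<^sub>R \<theta>2)"
    by (rule hG)
  also have "\<dots> = \<gamma> * infnorm (\<theta>1 - \<theta>2)"
    using \<open>0 \<le> \<gamma>\<close> by (simp add: infnorm_mul flip: scaleR_diff_right)
  finally show "infnorm (D_op \<gamma> F G \<theta>1 - D_op \<gamma> F G \<theta>2) \<le> \<gamma> * infnorm (\<theta>1 - \<theta>2)" .
qed

text \<open>
  The maxima have to be attained for the entries to stay below \<open>\<infinity>\<close>: a supremum of finite feature
  values could be infinite.
\<close>

lemma row_regular_G_s:
  assumes "0 < \<gamma>" "U \<noteq> {}"
    and no_top: "\<And>i u' j. u' \<in> U \<Longrightarrow> f (xp i, u') $ j \<noteq> \<infinity>"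
    and max: "\<And>i j. has_max_on (\<lambda>u'. f (xp i, u') $ j) U"
    and ex: "\<And>i u'. u' \<in> U \<Longrightarrow> \<exists>j. f (xp i, u') $ j \<noteq> -\<infinity>"
  shows "row_regular (G_s U \<gamma> f xp r)"
proof -
  define S where "S i j = (SUP u'\<in>U. f (xp i, u') $ j)" for i j
  have entry: "G_s U \<gamma> f xp r $ i $ j = ereal (r i) + ereal \<gamma> * S i j" for i j
    by (simp add: G_s_def bellman_s_def S_def)
  have top: "S i j \<noteq> \<infinity>" for i j
  proof -
    have "S i j \<in> (\<lambda>u'. f (xp i, u') $ j) ` U"
      unfolding S_def by (rule has_max_on_SUP(1)[OF max])
    then obtain u' where "u' \<in> U" "S i j = f (xp i, u') $ j"
      by (rule imageE)
    with no_top show ?thesis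
      by simp
  qed
  have bot: "\<exists>j. S i j \<noteq> -\<infinity>" for i
  proof -
    obtain u' where u': "u' \<in> U"
      using \<open>U \<noteq> {}\<close> by blast
    then obtain j where j: "f (xp i, u') $ j \<noteq> -\<infinity>"
      using ex by blast
    have "f (xp i, u') $ j \<le> S i j"
      unfolding S_def using u' by (rule SUP_upper)
    with j have "S i j \<noteq> -\<infinity>"
      by auto
    then show ?thesis ..
  qed
  have "ereal (r i) + ereal \<gamma> * S i j \<noteq> \<infinity>" for i j
    using top[of i j] \<open>0 < \<gamma>\<close> by (cases "S i j") auto
  moreover have "ereal (r i) + ereal \<gamma> * S i j \<noteq> -\<infinity>" if "S i j \<noteq> -\<infinity>" for i j
    using that \<open>0 < \<gamma>\<close> by (cases "S i j") auto
  ultimately show ?thesis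
    unfolding row_regular_def entry using bot by blast
qed

theorem theorem3p4:
  fixes X :: "(real^'dx) set" and U :: "(real^'du) set" and \<gamma> :: real
    and f :: "(real^'dx) \<times> (real^'du) \<Rightarrow> ereal^'p"
    and x :: "'n::finite \<Rightarrow> real^'dx" and u :: "'n \<Rightarrow> real^'du"
    and xp :: "'n \<Rightarrow> real^'dx" and r :: "'n \<Rightarrow> real"
    and z :: "'n \<Rightarrow> (real^'dx) \<times> (real^'du)"
    and F G :: "ereal^'p^'n"
  defines "z \<equiv> \<lambda>i. (x i, u i)"
    and "F \<equiv> F_s f z"
    and "G \<equiv> G_s U \<gamma> f xp r"
  assumes X_nonempty: "X \<noteq> {}" and U_nonempty: "U \<noteq> {}"
    and gamma: "0 < \<gamma>" "\<gamma> < 1"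
    and z_in: "\<And>i. z i \<in> X \<times> U"
    and xp_in: "\<And>i. xp i \<in> X"
    and f_no_top: "\<And>w j. w \<in> X \<times> U \<Longrightarrow> f w $ j \<noteq> \<infinity>"
    and f_max: "\<And>i j. has_max_on (\<lambda>u'. f (xp i, u') $ j) U"
    and cond1: "\<And>w. w \<in> X \<times> U \<Longrightarrow> \<exists>j. f w $ j \<noteq> -\<infinity>"
    and cond2: "\<And>j. \<exists>i. f (z i) $ j \<noteq> -\<infinity>"
  shows "(\<forall>\<theta>. ereal_vec (D_op \<gamma> F G \<theta>) = D_ext \<gamma> F G \<theta>) \<and>
         (\<forall>\<theta>1 \<theta>2. infnorm (D_op \<gamma> F G \<theta>1 - D_op \<gamma> F G \<theta>2) \<le> \<gamma> * infnorm (\<theta>1 - \<theta>2))"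
proof -
  have G: "row_regular G"
    unfolding G_def
    using xp_in by (intro row_regular_G_s gamma U_nonempty f_max f_no_top cond1) auto
  have F: "row_regular (transpose F)"
    using f_no_top[OF z_in] cond2
    by (simp add: row_regular_def F_def F_s_def transpose_def)
  show ?thesis
    using D_op_contraction[OF F G] gamma by simp
qed

end
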